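(* For all integers $n\geqslant 0$ and $r\geqslant 1$, $$\sum_{k=0}^\infty p(n-rT_k) = S_r(n).$$
   Context: $p(m)$ denotes the number of integer partitions of $m$, with $p(0)=1$ and $p(m)=0$ for $m<0$. $T_k=k(k+1)/2$ is the $k$-th triangular number. For a partition $\lambda$ and $r\geqslant 1$, the least $r$-gap $g_r(\lambda)$ is the smallest positive integer whose multiplicity as a part of $\lambda$ is less than $r$ (in particular the multiplicity may be $0$; e.g. $g_1(5)=1$, $g_1(3+1+1)=2$). $S_r(n)=\sum_{\lambda\vdash n} g_r(\lambda)$ is the sum of the least $r$-gaps over all partitions of $n$. *)

theory Defs
  imports Complex_Main "HOL-Library.Multiset"
begin

text \<open>
  Partitions are multisets of positive parts. The weight ranges over \<^typ>\<open>int\<close>, so that the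
  set is empty for a negative weight and the convention $p(m) = 0$ for $m < 0$ comes for free.
\<close>

definition integer_partitions :: "int \<Rightarrow> nat multiset set" where
  "integer_partitions m = {\<mu>. (\<forall>i\<in>#\<mu>. 0 < i) \<and> int (sum_mset \<mu>) = m}"

definition partition_count :: "int \<Rightarrow> nat" where
  "partition_count m = card (integer_partitions m)"

definition triangular :: "nat \<Rightarrow> nat" where
  "triangular k = k * (k + 1) div 2"

definition least_gap :: "nat \<Rightarrow> nat multiset \<Rightarrow> nat" where
  "least_gap r \<mu> = (LEAST i. 0 < i \<and> count \<mu> i < r)"

definition least_gap_sum :: "nat \<Rightarrow> nat \<Rightarrow> nat" where
  "least_gap_sum r n = (\<Sum>\<mu>\<in>integer_partitions (int n). least_gap r \<mu>)"

text \<open>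
  Finiteness ensures that \<^const>\<open>card\<close> and \<^const>\<open>sum\<close> above do not take their default value 0.
\<close>

lemma size_le_sum_mset:
  fixes \<mu> :: "nat multiset"
  assumes "\<forall>i\<in>#\<mu>. 0 < i"
  shows "size \<mu> \<le> sum_mset \<mu>"
  using assms by (induction \<mu>) auto

lemma finite_integer_partitions: "finite (integer_partitions m)"
proof (rule finite_subset)
  show "integer_partitions m \<subseteq> mset ` {xs. set xs \<subseteq> {..nat m} \<and> length xs \<le> nat m}"
  proof
    fix \<mu> assume "\<mu> \<in> integer_partitions m"
    then have pos: "\<forall>i\<in>#\<mu>. 0 < i" and sum: "sum_mset \<mu> = nat m"
      by (auto simp: integer_partitions_def simp del: of_nat_sum_mset)
    obtain xs where xs: "mset xs = \<mu>"
      using ex_mset by blast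
    have "i \<le> nat m" if "i \<in># \<mu>" for i
      using sum_mset.remove[OF that] sum by simp
    moreover have "length xs \<le> nat m"
      using size_le_sum_mset[OF pos] sum xs by auto
    ultimately show "\<mu> \<in> mset ` {xs. set xs \<subseteq> {..nat m} \<and> length xs \<le> nat m}"
      using xs by auto
  qed
qed (simp add: finite_lists_length_le)

lemma partition_count_0: "partition_count 0 = 1"
proof -
  have "\<mu> = {#}" if "\<mu> \<in> integer_partitions 0" for \<mu>
    using that size_le_sum_mset[of \<mu>]
    by (simp add: integer_partitions_def del: of_nat_sum_mset sum_mset_0_iff)
  then have "integer_partitions 0 = {{#}}"
    by (auto simp: integer_partitions_def)
  then show ?thesis
    by (simp add: partition_count_def)
qed

lemma partition_count_neg:
  assumes "m < 0"
  shows "partition_count m = 0"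
proof -
  have "integer_partitions m = {}"
    using assms by (auto simp: integer_partitions_def simp del: of_nat_sum_mset)
  then show ?thesis
    by (simp add: partition_count_def)
qed

lemma least_gap_properties:
  assumes "r \<ge> 1"
  shows "0 < least_gap r \<mu>" "count \<mu> (least_gap r \<mu>) < r"
    "\<lbrakk>0 < i; count \<mu> i < r\<rbrakk> \<Longrightarrow> least_gap r \<mu> \<le> i"
proof -
  have "\<exists>i. i \<notin> insert 0 (set_mset \<mu>)"
    by (intro ex_new_if_finite infinite_UNIV_nat) simp
  then have "\<exists>i. 0 < i \<and> count \<mu> i < r"
    using assms by (auto simp: not_in_iff)
  then have "0 < least_gap r \<mu> \<and> count \<mu> (least_gap r \<mu>) < r"
    unfolding least_gap_def by (rule LeastI_ex)
  then show "0 < least_gap r \<mu>" "count \<mu> (least_gap r \<mu>) < r"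
    by auto
  show "least_gap r \<mu> \<le> i" if "0 < i" "count \<mu> i < r"
    unfolding least_gap_def using that by (intro Least_le) auto
qed

end

(*
  Adding r copies of each of 1, ..., k to a partition of n - r T_k is a bijection onto the
  partitions of n whose least r-gap exceeds k. Hence the left-hand side counts the pairs
  of a partition of n and a natural number k below its least r-gap.
*)
theory Submission
  imports Defs
begin

definition staircase :: "nat \<Rightarrow> nat \<Rightarrow> nat multiset" where
  "staircase r k = (\<Sum>i\<in>{1..k}. replicate_mset r i)"

lemma count_staircase: "count (staircase r k) i = (if 1 \<le> i \<and> i \<le> k then r else 0)"
  by (simp add: staircase_def count_sum)

lemma sum_mset_staircase: "sum_mset (staircase r k) = r * triangular k"
proof (induction k)
  case (Suc k)
  have "staircase r (Suc k) = replicate_mset r (Suc k) + staircase r k"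
    by (simp add: staircase_def)
  moreover have "triangular (Suc k) = Suc k + triangular k"
    by (simp add: triangular_def)
  ultimately show ?case
    using Suc by (simp add: distrib_left)
qed (simp add: staircase_def triangular_def)

text \<open>By minimality, no positive \<open>i\<close> below the least gap has multiplicity less
  than \<open>r\<close>; this gives the inclusion when the gap exceeds \<open>k\<close>.\<close>

lemma less_least_gap_iff_staircase_subset:
  assumes "r \<ge> 1"
  shows "k < least_gap r \<mu> \<longleftrightarrow> staircase r k \<subseteq># \<mu>"
proof
  assume "k < least_gap r \<mu>"
  then have "r \<le> count \<mu> i" if "1 \<le> i" "i \<le> k" for i
    using least_gap_properties(3)[OF assms, of i \<mu>] that by linarith
  then show "staircase r k \<subseteq># \<mu>"
    by (simp add: subseteq_mset_def count_staircase)
next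
  assume "staircase r k \<subseteq># \<mu>"
  \<comment> \<open>Compare multiplicities at the gap itself: it is positive and occurs fewer than
    \<open>r\<close> times in \<open>\<mu>\<close>, so it cannot lie in
    \<open>{1..k}\<close>.\<close>
  then have "count (staircase r k) (least_gap r \<mu>) \<le> count \<mu> (least_gap r \<mu>)"
    by (rule mset_subset_eq_count)
  with least_gap_properties(1,2)[OF assms, of \<mu>] show "k < least_gap r \<mu>"
    by (simp add: count_staircase split: if_splits)
qed

text \<open>Adding \<open>\<delta>\<close> is injective by cancellation, and removing it from a
  partition that contains it leaves positive parts. Integer weights also cover the case where
  \<open>m\<close> is less than the sum of \<open>\<delta>\<close>: both sets are then
  empty.\<close>

lemma partition_count_diff:
  fixes \<delta> :: "nat multiset"
  assumes "\<forall>i\<in>#\<delta>. 0 < i"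
  shows "partition_count (m - int (sum_mset \<delta>)) = card {\<mu> \<in> integer_partitions m. \<delta> \<subseteq># \<mu>}"
  unfolding partition_count_def
proof (rule bij_betw_same_card)
  have "(\<lambda>\<nu>. \<delta> + \<nu>) ` integer_partitions (m - int (sum_mset \<delta>))
      = {\<mu> \<in> integer_partitions m. \<delta> \<subseteq># \<mu>}"
    using assms
    by (auto simp: integer_partitions_def mset_subset_eq_exists_conv simp del: of_nat_sum_mset)
  then show "bij_betw (\<lambda>\<nu>. \<delta> + \<nu>) (integer_partitions (m - int (sum_mset \<delta>)))
      {\<mu> \<in> integer_partitions m. \<delta> \<subseteq># \<mu>}"
    by (simp add: bij_betw_def)
qed

lemma partition_count_diff_triangular:
  assumes "r \<ge> 1"
  shows "partition_count (m - int r * int (triangular k))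
    = card {\<mu> \<in> integer_partitions m. k < least_gap r \<mu>}"
proof -
  have "\<forall>i\<in>#staircase r k. 0 < i"
    by (auto simp: count_staircase simp flip: count_greater_zero_iff split: if_splits)
  from partition_count_diff[OF this, of m] show ?thesis
    by (simp add: sum_mset_staircase less_least_gap_iff_staircase_subset[OF assms]
        del: of_nat_sum_mset)
qed

theorem theorem1:
  fixes n r :: nat
  assumes "r \<ge> 1"
  shows "(\<lambda>k. partition_count (int n - int r * int (triangular k))) sums least_gap_sum r n"
proof -
  let ?P = "integer_partitions (int n)"
  let ?N = "least_gap_sum r n"
  \<comment> \<open>The total \<open>?N\<close> bounds each of its natural summands, so it is a
    uniform cutoff for \<open>k\<close>.\<close>
  have le: "least_gap r \<mu> \<le> ?N" if "\<mu> \<in> ?P" for \<mu>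
    unfolding least_gap_sum_def
    using that by (intro member_le_sum) (auto simp: finite_integer_partitions)
  \<comment> \<open>Double counting of the pairs of \<open>k\<close> and \<open>\<mu>\<close> with
    \<open>k < least_gap r \<mu>\<close>; each \<open>\<mu>\<close> admits exactly
    \<open>least_gap r \<mu>\<close> values of \<open>k\<close>, starting from 0.\<close>
  have "(\<Sum>k<?N. card {\<mu> \<in> ?P. k < least_gap r \<mu>}) = (\<Sum>\<mu>\<in>?P. card {k \<in> {..<?N}. k < least_gap r \<mu>})"
    using finite_integer_partitions
    by (intro sum_multicount_gen) auto
  also have "\<dots> = ?N"
  proof -
    have "{k \<in> {..<?N}. k < least_gap r \<mu>} = {..<least_gap r \<mu>}" if "\<mu> \<in> ?P" for \<mu>
      using le[OF that] by auto
    then show ?thesis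
      by (simp add: least_gap_sum_def)
  qed
  finally have "(\<Sum>k<?N. card {\<mu> \<in> ?P. k < least_gap r \<mu>}) = ?N" .
  \<comment> \<open>All terms from \<open>?N\<close> on vanish, so the series reduces to the finite
    sum.\<close>
  moreover have "card {\<mu> \<in> ?P. k < least_gap r \<mu>} = 0" if "k \<notin> {..<?N}" for k
  proof -
    have "{\<mu> \<in> ?P. k < least_gap r \<mu>} = {}"
      using that by (auto dest: le)
    then show ?thesis
      by (simp only: card.empty)
  qed
  ultimately show ?thesis
    using sums_finite[of "{..<?N}" "\<lambda>k. card {\<mu> \<in> ?P. k < least_gap r \<mu>}"]
    by (simp add: partition_count_diff_triangular[OF assms])
qed

end
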